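(* Let $N\in\mathbb{I}_{\ge1}$, and let $\overline\gamma_{\mathrm{f}}\ge 1$, $\gamma_{k,\mathrm{f}}\in[1,\overline\gamma_{\mathrm{f}}]$, $k\in\mathbb{I}_{\ge1}$, and $\underline c_{\mathrm{f}},\overline c_{\mathrm{f}},\epsilon_{\mathrm{f}}>0$ be constants with $\underline c_{\mathrm{f}}\le\frac{\gamma_{1,\mathrm{f}}}{1+\epsilon_{\mathrm{f}}}\le\overline c_{\mathrm{f}}$. Let $\underline\gamma_{\mathrm{o}}=\overline\gamma_{\mathrm{o}}=0$, $\epsilon_{\mathrm{o}}=1$, and let $\alpha_{N,\mathrm{f}}$ be defined by the linear program $$(\alpha_{N,\mathrm{f}}-1)\epsilon_{\mathrm{o}}:=\min_{\tilde\ell,\tilde W,\tilde\sigma,\tilde V,\tilde V_{\mathrm{f}}}\ \sum_{k=1}^{N-1}\tilde\ell_k+\tilde V_{\mathrm{f}}-\tilde V$$ over real variables $\tilde\ell_k$ ($k\in\mathbb{I}_{[0,N-1]}$), $\tilde W_k,\tilde\sigma_k$ ($k\in\mathbb{I}_{[0,N]}$), $\tilde V$, $\tilde V_{\mathrm{f}}$, subject to \begin{align*} &\tilde\sigma_0=1,\quad \tilde\ell_k\ge0,\ k\in\mathbb{I}_{[0,N-1]},\quad \tilde V_{\mathrm{f}}\ge0,\quad \tilde\sigma_k\ge0,\ \tilde W_k\ge0,\ k\in\mathbb{I}_{[0,N]},\\ &\underline{\gamma}_{\mathrm{o}}\tilde\sigma_k\le\tilde W_k\le\overline{\gamma}_{\mathrm{o}}\tilde\sigma_k,\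 k\in\mathbb{I}_{[0,N]},\\ &\tilde W_{k+1}-\tilde W_k\le-\epsilon_{\mathrm{o}}\tilde\sigma_k+\tilde\ell_k,\ k\in\mathbb{I}_{[0,N-1]},\\ &\textstyle\sum_{j=k}^{N-1}\tilde\ell_j+\tilde V_{\mathrm{f}}\le\gamma_{N-k,\mathrm{f}}\tilde\sigma_k,\ k\in\mathbb{I}_{[0,N-1]},\\ &\textstyle\tilde V\le\sum_{j=1}^{k-1}\tilde\ell_j+\gamma_{N-k+1,\mathrm{f}}\tilde\sigma_k,\ k\in\mathbb{I}_{[1,N]},\\ &\textstyle\tilde V\le\sum_{j=1}^{N-1}\tilde\ell_j+(1+\epsilon_{\mathrm{f}})\tilde V_{\mathrm{f}},\\ &\underline c_{\mathrm{f}}\tilde\sigma_N\le\tilde V_{\mathrm{f}}\le\overline c_{\mathrm{f}}\tilde\sigma_N. \end{align*} Then $$\alpha_{N,\mathrm{f}}\ge\hat\alpha_{N,\mathrm{f}}:=1-\frac{\epsilon_{\mathrm{f}}(\gamma_{N,\mathrm{f}}-1)\prod_{j=1}^{N-1}(\gamma_{N-j+1,\mathrm{f}}-1)}{(1+\epsilon_{\mathrm{f}})\prod_{j=1}^{N-1}\gamma_{N-j+1,\mathrm{f}}-\epsilon_{\mathrm{f}}\prod_{j=1}^{N-1}(\gamma_{N-j+1,\mathrm{f}}-1)}.$$ Furthermore, $\hat\alpha_{N,\mathrm{f}}=\alpha_{N,\mathrm{f}}$ if there are real sequences $(c_k)_{k\ge0}$, $(c_{k,\mathrm{f}})_{k\ge0}$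 such that $\gamma_{k,\mathrm{f}}=\sum_{j=0}^{k-1}c_j+c_{k,\mathrm{f}}$ for all $k\in\mathbb{I}_{\ge1}$ and, for all $k,k_2\in\mathbb{I}_{\ge0}$, $$c_{k+k_2}\le c_kc_{k_2},\qquad c_{k+k_2,\mathrm{f}}\le c_kc_{k_2,\mathrm{f}},\qquad c_k+c_{k+1,\mathrm{f}}\le(1+\epsilon_{\mathrm{f}})c_{k,\mathrm{f}}.$$ In addition, $\alpha_{N,\mathrm{f}}>0$ for $$N>\underline N_{\mathrm{f}}:=1+\frac{\log(\overline\gamma_{\mathrm{f}})-\log(1+1/\epsilon_{\mathrm{f}})}{\log(\overline\gamma_{\mathrm{f}})-\log(\overline\gamma_{\mathrm{f}}-1)}.$$
   Context: $\mathbb{I}_{[a,b]}$ (resp. $\mathbb{I}_{\ge a}$) denotes the integers in $[a,b]$ (resp. $\ge a$). Empty sums are $0$ and empty products are $1$. *)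

theory Defs
  imports Complex_Main
begin

text \<open>
  Constraints of the linear program with horizon \<open>N\<close> and data \<open>\<gamma>\<close> (the sequence
  \<open>\<gamma>\<^sub>k\<^sub>,\<^sub>f\<close>, only used for \<open>k \<ge> 1\<close>), \<open>go_lo\<close>, \<open>go_up\<close> (the lower and upper
  \<open>\<gamma>\<^sub>o\<close>), \<open>eo\<close>, \<open>ef\<close> (\<open>\<epsilon>\<^sub>o\<close>, \<open>\<epsilon>\<^sub>f\<close>) and \<open>c_lo\<close>, \<open>c_up\<close> (the lower and upper
  \<open>c\<^sub>f\<close>).  The decision variables \<open>l\<close>, \<open>W\<close>, \<open>\<sigma>\<close> are total functions on the naturals;
  no constraint and no term of the objective involves \<open>l k\<close> for \<open>k \<ge> N\<close> or
  \<open>W k\<close>, \<open>\<sigma> k\<close> for \<open>k > N\<close>.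
\<close>

definition lp_feasible ::
  "nat \<Rightarrow> (nat \<Rightarrow> real) \<Rightarrow> real \<Rightarrow> real \<Rightarrow> real \<Rightarrow> real \<Rightarrow> real \<Rightarrow> real \<Rightarrow>
   (nat \<Rightarrow> real) \<Rightarrow> (nat \<Rightarrow> real) \<Rightarrow> (nat \<Rightarrow> real) \<Rightarrow> real \<Rightarrow> real \<Rightarrow> bool" where
  "lp_feasible N \<gamma> go_lo go_up eo ef c_lo c_up l W \<sigma> V Vf \<longleftrightarrow>
     \<sigma> 0 = 1 \<and> (\<forall>k<N. 0 \<le> l k) \<and> 0 \<le> Vf \<and> (\<forall>k\<le>N. 0 \<le> \<sigma> k \<and> 0 \<le> W k) \<and>
     (\<forall>k\<le>N. go_lo * \<sigma> k \<le> W k \<and> W k \<le> go_up * \<sigma> k) \<and>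
     (\<forall>k<N. W (k + 1) - W k \<le> - eo * \<sigma> k + l k) \<and>
     (\<forall>k<N. (\<Sum>j=k..<N. l j) + Vf \<le> \<gamma> (N - k) * \<sigma> k) \<and>
     (\<forall>k\<in>{1..N}. V \<le> (\<Sum>j=1..<k. l j) + \<gamma> (N - k + 1) * \<sigma> k) \<and>
     V \<le> (\<Sum>j=1..<N. l j) + (1 + ef) * Vf \<and>
     c_lo * \<sigma> N \<le> Vf \<and> Vf \<le> c_up * \<sigma> N"

text \<open>
  \<open>LEAST\<close> is the minimum of the set of objective values at feasible points; it is
  unspecified unless that minimum is attained.
\<close>

definition lp_min ::
  "nat \<Rightarrow> (nat \<Rightarrow> real) \<Rightarrow> real \<Rightarrow> real \<Rightarrow> real \<Rightarrow> real \<Rightarrow> real \<Rightarrow> real \<Rightarrow> real" where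
  "lp_min N \<gamma> go_lo go_up eo ef c_lo c_up =
     (LEAST v. \<exists>l W \<sigma> V Vf. lp_feasible N \<gamma> go_lo go_up eo ef c_lo c_up l W \<sigma> V Vf \<and>
        v = (\<Sum>k=1..<N. l k) + Vf - V)"

text \<open>The number \<open>\<alpha>\<close> with \<open>(\<alpha> - 1) * eo = lp_min \<dots>\<close>, for \<open>eo \<noteq> 0\<close>.\<close>

definition alpha ::
  "nat \<Rightarrow> (nat \<Rightarrow> real) \<Rightarrow> real \<Rightarrow> real \<Rightarrow> real \<Rightarrow> real \<Rightarrow> real \<Rightarrow> real \<Rightarrow> real" where
  "alpha N \<gamma> go_lo go_up eo ef c_lo c_up =
     1 + lp_min N \<gamma> go_lo go_up eo ef c_lo c_up / eo"

definition alpha_hat :: "nat \<Rightarrow> (nat \<Rightarrow> real) \<Rightarrow> real \<Rightarrow> real" where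
  "alpha_hat N \<gamma> ef =
     1 - ef * (\<gamma> N - 1) * (\<Prod>j=1..<N. \<gamma> (N - j + 1) - 1) /
         ((1 + ef) * (\<Prod>j=1..<N. \<gamma> (N - j + 1)) - ef * (\<Prod>j=1..<N. \<gamma> (N - j + 1) - 1))"

text \<open>
  For \<open>g = 1\<close> the quotient is to be read with \<open>log 0 = -\<infinity>\<close>, so that it is \<open>0\<close>
  and the bound is \<open>1\<close>.  The formula below gives the same value, because
  \<open>ln 0 = 0\<close> and \<open>x / 0 = 0\<close>.
\<close>

definition N_lower :: "real \<Rightarrow> real \<Rightarrow> real" where
  "N_lower g ef = 1 + (ln g - ln (1 + 1 / ef)) / (ln g - ln (g - 1))"

end

theory Submission
  imports Defs "HOL-Analysis.Function_Topology"
begin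

text \<open>
  With both storage bounds equal to \<open>0\<close>, all \<open>W k\<close> vanish and the program reduces to
  \<open>\<sigma> k \<le> l k\<close> together with the bounds involving \<open>\<gamma>\<close>.  Write \<open>S k\<close> for the tail cost
  \<open>(\<Sum>j=k..<N. l j) + Vf\<close>, so that the objective is \<open>- D\<close> with \<open>D = V - S 1\<close>, and put
  \<open>T k = D + S k\<close>.  The upper bound on \<open>V\<close> at a stage \<open>0 < k < N\<close> then implies
  \<open>T k \<le> \<gamma> (N - k + 1) * (T k - T (k + 1))\<close>, that is, \<open>T\<close> contracts by the factor
  \<open>1 - 1 / \<gamma> (N - k + 1)\<close> in each step.  The two ends of this chain are controlled by \<open>D\<close>:
  the bound at \<open>k = 0\<close> gives \<open>T 1 \<le> D + \<gamma> N - 1\<close>, and the terminal bound on \<open>V\<close> gives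
  \<open>D \<le> ef * Vf\<close>, hence \<open>T N \<ge> D * (1 + 1 / ef)\<close>.  Solving the resulting linear inequality
  for \<open>D\<close> yields \<open>alpha_hat\<close> (\<open>objective_lower_bound\<close>).  As the minimum is taken by
  \<open>LEAST\<close>, this bounds \<open>alpha\<close> only once the minimum is known to be attained
  (\<open>lp_min_attained\<close>); this follows from compactness.

  Demanding equality in all these inequalities determines a candidate for a point where the
  bound is attained.  For general data it may violate the tail bounds at stages \<open>0 < k < N\<close>;
  at stage \<open>k = N - m\<close> the candidate satisfies them if
  \<open>(1 + ef) * (\<gamma> (m + 1) - \<gamma> m) * (\<Prod>i=2..m. \<gamma> i) \<le> ef * (\<Prod>i=2..m + 1. \<gamma> i - 1)\<close>
  (\<open>extremal_point_exists\<close>).  Submultiplicativity of the sequences \<open>c\<close> and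
  \<open>cf\<close>, together with \<open>c k + cf (k + 1) \<le> (1 + ef) * cf k\<close>, implies this inequality
  (\<open>increment_bound\<close>).

  For positivity, \<open>alpha_hat > 0\<close> unfolds to
  \<open>ef * \<gamma> N * (\<Prod>j=1..<N. 1 - 1 / \<gamma> (N - j + 1)) < 1 + ef\<close>; the left-hand side is increasing
  in every \<open>\<gamma> k\<close>, so all of them may be replaced by their common bound \<open>g_up\<close>, and taking
  logarithms gives the stated horizon.
\<close>

section \<open>Elimination of the storage variables\<close>

definition reduced_feasible ::
  "nat \<Rightarrow> (nat \<Rightarrow> real) \<Rightarrow> real \<Rightarrow> real \<Rightarrow> real \<Rightarrow>
   (nat \<Rightarrow> real) \<Rightarrow> (nat \<Rightarrow> real) \<Rightarrow> real \<Rightarrow> real \<Rightarrow> bool" where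
  "reduced_feasible N \<gamma> ef c_lo c_up l \<sigma> V Vf \<longleftrightarrow>
     \<sigma> 0 = 1 \<and> 0 \<le> Vf \<and> (\<forall>k\<in>{..N}. 0 \<le> \<sigma> k) \<and> (\<forall>k\<in>{..<N}. \<sigma> k \<le> l k) \<and>
     (\<forall>k\<in>{..<N}. (\<Sum>j=k..<N. l j) + Vf \<le> \<gamma> (N - k) * \<sigma> k) \<and>
     (\<forall>k\<in>{1..N}. V \<le> (\<Sum>j=1..<k. l j) + \<gamma> (N - k + 1) * \<sigma> k) \<and>
     V \<le> (\<Sum>j=1..<N. l j) + (1 + ef) * Vf \<and>
     c_lo * \<sigma> N \<le> Vf \<and> Vf \<le> c_up * \<sigma> N"

lemma lp_feasible_iff_reduced:
  "lp_feasible N \<gamma> 0 0 1 ef c_lo c_up l W \<sigma> V Vf \<longleftrightarrow>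
     (\<forall>k\<le>N. W k = 0) \<and> reduced_feasible N \<gamma> ef c_lo c_up l \<sigma> V Vf"
  (is "?L \<longleftrightarrow> ?R")
proof
  assume L: ?L
  have W: "\<forall>k\<le>N. W k = 0"
    using L unfolding lp_feasible_def by (auto intro: antisym)
  have "\<sigma> k \<le> l k" if "k < N" for k
  proof -
    have "W (k + 1) - W k \<le> - 1 * \<sigma> k + l k"
      using L that unfolding lp_feasible_def by blast
    with W that show ?thesis by simp
  qed
  with L W show ?R unfolding lp_feasible_def reduced_feasible_def by auto
next
  assume R: ?R
  then have "0 \<le> l k" if "k < N" for k
    using that unfolding reduced_feasible_def by (meson atMost_iff lessThan_iff less_imp_le order_trans)
  with R show ?L unfolding lp_feasible_def reduced_feasible_def by auto
qed

lemma lp_min_eqI: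
  assumes "reduced_feasible N \<gamma> ef c_lo c_up l \<sigma> V Vf"
    and "\<And>l' \<sigma>' V' Vf'. reduced_feasible N \<gamma> ef c_lo c_up l' \<sigma>' V' Vf' \<Longrightarrow>
      (\<Sum>k=1..<N. l k) + Vf - V \<le> (\<Sum>k=1..<N. l' k) + Vf' - V'"
  shows "lp_min N \<gamma> 0 0 1 ef c_lo c_up = (\<Sum>k=1..<N. l k) + Vf - V"
  unfolding lp_min_def
proof (rule Least_equality)
  have "lp_feasible N \<gamma> 0 0 1 ef c_lo c_up l (\<lambda>_. 0) \<sigma> V Vf"
    using assms(1) by (simp add: lp_feasible_iff_reduced)
  then show "\<exists>l' W \<sigma> V' Vf'. lp_feasible N \<gamma> 0 0 1 ef c_lo c_up l' W \<sigma> V' Vf' \<and>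
      (\<Sum>k=1..<N. l k) + Vf - V = (\<Sum>k=1..<N. l' k) + Vf' - V'"
    by blast
qed (auto simp: lp_feasible_iff_reduced simp del: One_nat_def intro: assms(2))

section \<open>Attainment of the minimum\<close>

text \<open>
  Tychonoff's theorem makes it possible to keep the decision variables as functions on the
  naturals instead of passing to vectors whose dimension depends on \<open>N\<close>.
\<close>

lemma compact_product_Icc:
  fixes a b :: real
  shows "compact {f :: nat \<Rightarrow> real. \<forall>k. f k \<in> {a..b}}"
proof -
  have "compactin (product_topology (\<lambda>k::nat. euclidean) UNIV) (PiE UNIV (\<lambda>k. {a..b}))"
    unfolding compactin_PiE by (simp add: compact_Icc)
  moreover have "PiE UNIV (\<lambda>k::nat. {a..b}) = {f. \<forall>k. f k \<in> {a..b}}"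
    by (auto simp: PiE_def Pi_def)
  ultimately show ?thesis
    by (simp add: euclidean_product_topology)
qed

lemma closed_reduced_feasible:
  "closed {(l, \<sigma>, V, Vf). reduced_feasible N \<gamma> ef c_lo c_up l \<sigma> V Vf}"
proof -
  have l: "continuous_on UNIV (\<lambda>x :: (nat \<Rightarrow> real) \<times> (nat \<Rightarrow> real) \<times> real \<times> real. fst x k)"
    and s: "continuous_on UNIV (\<lambda>x :: (nat \<Rightarrow> real) \<times> (nat \<Rightarrow> real) \<times> real \<times> real. fst (snd x) k)" for k
    by (rule continuous_on_product_then_coordinatewise, intro continuous_intros)+
  show ?thesis
    unfolding reduced_feasible_def case_prod_unfold Ball_def
    by (intro closed_Collect_conj closed_Collect_all closed_Collect_imp closed_Collect_le
        closed_Collect_eq open_Collect_const continuous_intros l s)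
qed

text \<open>
  The feasible set itself is unbounded: \<open>V\<close> may tend to \<open>-\<infinity>\<close>, and the variables beyond the
  horizon are arbitrary.  Setting the latter to \<open>0\<close> and replacing \<open>V\<close> by \<open>max V 0\<close> moves any
  feasible point, without increasing the objective, into a box whose size is dictated by the
  tail bound at \<open>k = 0\<close> and, for \<open>\<sigma> N\<close>, by \<open>c_lo\<close>.  On the feasible part of that box the objective attains its infimum.
\<close>

lemma lp_min_attained:
  fixes \<gamma> :: "nat \<Rightarrow> real"
  assumes N: "N \<ge> 1" and gamma: "\<And>k. k \<ge> 1 \<Longrightarrow> 1 \<le> \<gamma> k"
    and pos: "c_lo > 0" "ef > 0"
  obtains l \<sigma> V Vf where "reduced_feasible N \<gamma> ef c_lo c_up l \<sigma> V Vf"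
    and "lp_min N \<gamma> 0 0 1 ef c_lo c_up = (\<Sum>k=1..<N. l k) + Vf - V"
proof -
  let ?F = "reduced_feasible N \<gamma> ef c_lo c_up"
  define M where "M = (2 + ef + 1 / c_lo) * \<gamma> N"
  let ?box = "{f :: nat \<Rightarrow> real. \<forall>k. f k \<in> {0..M}}"
  define K where "K = (?box \<times> ?box \<times> {0..M} \<times> {0..M}) \<inter> {(l, \<sigma>, V, Vf). ?F l \<sigma> V Vf}"
  define obj :: "(nat \<Rightarrow> real) \<times> (nat \<Rightarrow> real) \<times> real \<times> real \<Rightarrow> real"
    where "obj x = (\<Sum>k=1..<N. fst x k) + snd (snd (snd x)) - fst (snd (snd x))" for x
  have gN: "1 \<le> \<gamma> N" using gamma N by simp
  have M: "\<gamma> N \<le> M" "(2 + ef) * \<gamma> N \<le> M" "\<gamma> N / c_lo \<le> M"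
    using gN pos by (simp_all add: M_def algebra_simps add_nonneg_nonneg)

  have compK: "compact K"
    unfolding K_def
    by (intro compact_Int_closed compact_Times compact_product_Icc compact_Icc
        closed_reduced_feasible)
  have "continuous_on UNIV (\<lambda>x :: (nat \<Rightarrow> real) \<times> (nat \<Rightarrow> real) \<times> real \<times> real. fst x k)" for k
    by (rule continuous_on_product_then_coordinatewise, intro continuous_intros)
  then have contobj: "continuous_on K obj"
    unfolding obj_def by (intro continuous_intros) (auto intro: continuous_on_subset)

  have into_K: "\<exists>x\<in>K. obj x \<le> (\<Sum>k=1..<N. l k) + Vf - V" if F: "?F l \<sigma> V Vf" for l \<sigma> V Vf
  proof -
    define l' where "l' k = (if k < N then l k else 0)" for k
    define \<sigma>' where "\<sigma>' k = (if k \<le> N then \<sigma> k else 0)" for k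
    have s0: "0 \<le> \<sigma> k" if "k \<le> N" for k using F that by (auto simp: reduced_feasible_def)
    have sl: "\<sigma> k \<le> l k" if "k < N" for k using F that by (auto simp: reduced_feasible_def)
    have l0: "0 \<le> l k" if "k < N" for k using s0[of k] sl[of k] that by simp
    have Vf0: "0 \<le> Vf" using F by (simp add: reduced_feasible_def)
    have tot: "(\<Sum>j=0..<N. l j) + Vf \<le> \<gamma> N"
      using F N by (force simp: reduced_feasible_def)
    have sum0: "0 \<le> (\<Sum>j=a..<b. l j)" if "b \<le> N" for a b
      using that l0 by (intro sum_nonneg) auto
    have VfN: "Vf \<le> \<gamma> N" using tot sum0[of N 0] by simp
    have lN: "l k \<le> \<gamma> N" if "k < N" for k
    proof -
      have "l k \<le> (\<Sum>j=0..<N. l j)" using that l0 by (intro member_le_sum) auto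
      with tot Vf0 show ?thesis by simp
    qed
    have sN: "\<sigma> N \<le> \<gamma> N / c_lo"
    proof -
      have "c_lo * \<sigma> N \<le> \<gamma> N" using F VfN by (simp add: reduced_feasible_def)
      then show ?thesis using pos by (simp add: field_simps)
    qed
    have VM: "V \<le> M"
    proof -
      have "V \<le> (\<Sum>j=1..<N. l j) + (1 + ef) * Vf" using F by (simp add: reduced_feasible_def)
      moreover have "(\<Sum>j=1..<N. l j) \<le> \<gamma> N"
        using tot Vf0 l0[of 0] N by (simp add: sum.atLeast_Suc_lessThan)
      moreover have "(1 + ef) * Vf \<le> (1 + ef) * \<gamma> N" using VfN pos by simp
      ultimately show ?thesis using M(2) by (simp add: algebra_simps)
    qed
    have sM: "\<sigma> k \<le> M" if "k \<le> N" for k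
    proof (cases "k = N")
      case True then show ?thesis using sN M(3) by simp
    next
      case False
      then have "k < N" using that by simp
      then show ?thesis using sl[of k] lN[of k] M(1) by simp
    qed
    have lM: "l k \<le> M" if "k < N" for k using lN[OF that] M(1) by simp
    have M0: "0 \<le> M" using M(1) gN by simp
    have eqs: "(\<Sum>j=a..<b. l' j) = (\<Sum>j=a..<b. l j)" if "b \<le> N" for a b
      using that by (intro sum.cong) (auto simp: l'_def)
    \<comment> \<open>Raising a negative \<open>V\<close> to \<open>0\<close> keeps every upper bound on \<open>V\<close> valid, since these bounds
      are sums of nonnegative terms, and it lowers the objective.\<close>
    have "?F l' \<sigma>' (max V 0) Vf"
    proof -
      have "0 \<le> \<gamma> (N - k + 1) * \<sigma> k" if "k \<le> N" for k
        using gamma[of "N - k + 1"] s0[OF that] by simp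
      then show ?thesis
        using F N pos sum0 Vf0 unfolding reduced_feasible_def
        by (auto simp: eqs l'_def \<sigma>'_def)
    qed
    then have "(l', \<sigma>', max V 0, Vf) \<in> K"
      using s0 l0 lM sM VM Vf0 VfN M(1) M0 by (auto simp: K_def l'_def \<sigma>'_def)
    moreover have "obj (l', \<sigma>', max V 0, Vf) \<le> (\<Sum>k=1..<N. l k) + Vf - V"
      by (simp add: obj_def eqs)
    ultimately show ?thesis by blast
  qed

  have "?F (\<lambda>k. if k = 0 then 1 else 0) (\<lambda>k. if k = 0 then 1 else 0) 0 0"
  proof -
    have "(\<Sum>j=k..<N. if j = 0 then 1 else 0 :: real) = (if k = 0 then 1 else 0)" for k
      using N by (cases "k = 0") (auto simp: sum.atLeast_Suc_lessThan intro!: sum.neutral)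
    then show ?thesis
      using N gamma by (auto simp: reduced_feasible_def intro!: sum_nonneg)
  qed
  from into_K[OF this] have "K \<noteq> {}" by blast
  then obtain x where x: "x \<in> K" "\<forall>y\<in>K. obj x \<le> obj y"
    using continuous_attains_inf[OF compK _ contobj] by blast
  obtain l \<sigma> V Vf where x_eq: "x = (l, \<sigma>, V, Vf)" by (cases x) auto
  have F: "?F l \<sigma> V Vf" using x(1) by (simp add: K_def x_eq)
  moreover have "lp_min N \<gamma> 0 0 1 ef c_lo c_up = (\<Sum>k=1..<N. l k) + Vf - V"
  proof (rule lp_min_eqI[OF F])
    fix l' \<sigma>' V' Vf' assume "?F l' \<sigma>' V' Vf'"
    from into_K[OF this] x(2) have "obj x \<le> (\<Sum>k=1..<N. l' k) + Vf' - V'"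
      by (meson order_trans)
    then show "(\<Sum>k=1..<N. l k) + Vf - V \<le> (\<Sum>k=1..<N. l' k) + Vf' - V'"
      by (simp add: obj_def x_eq)
  qed
  ultimately show ?thesis using that by blast
qed

section \<open>The lower bound\<close>

lemma denominator_pos:
  fixes g :: "nat \<Rightarrow> real"
  assumes "\<And>k. k \<in> A \<Longrightarrow> 1 \<le> g k" and "ef > 0"
  shows "ef * (\<Prod>k\<in>A. g k - 1) < (1 + ef) * (\<Prod>k\<in>A. g k)"
proof -
  have "(\<Prod>k\<in>A. g k - 1) \<le> (\<Prod>k\<in>A. g k)"
    using assms by (intro prod_mono) auto
  then have "ef * (\<Prod>k\<in>A. g k - 1) \<le> ef * (\<Prod>k\<in>A. g k)"
    using assms by simp
  moreover have "0 < (\<Prod>k\<in>A. g k)"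
    using assms by (intro prod_pos) (meson less_le_trans zero_less_one)
  ultimately show ?thesis by (simp add: algebra_simps)
qed

text \<open>
  The products in \<open>alpha_hat\<close> accumulate from the contraction \<open>contract\<close>.  In this
  form the only multipliers are \<open>\<gamma> (N - k + 1)\<close> and \<open>\<gamma> (N - k + 1) - 1\<close>, which are nonnegative, so
  the contractions can be chained whatever the sign of \<open>T k\<close>.
\<close>

lemma objective_lower_bound:
  fixes \<gamma> :: "nat \<Rightarrow> real"
  assumes F: "reduced_feasible N \<gamma> ef c_lo c_up l \<sigma> V Vf"
    and N: "N \<ge> 1" and gamma: "\<And>k. k \<ge> 1 \<Longrightarrow> 1 \<le> \<gamma> k" and ef: "ef > 0"
  shows "alpha_hat N \<gamma> ef - 1 \<le> (\<Sum>k=1..<N. l k) + Vf - V"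
proof -
  define S where "S k = (\<Sum>j=k..<N. l j) + Vf" for k
  define D where "D = V - S 1"
  define T where "T k = D + S k" for k
  define P where "P k = (\<Prod>j=1..<k. \<gamma> (N - j + 1))" for k
  define Q where "Q k = (\<Prod>j=1..<k. \<gamma> (N - j + 1) - 1)" for k
  have P0: "0 < P k" for k
    unfolding P_def by (intro prod_pos) (use gamma in \<open>force intro: less_le_trans[OF zero_less_one]\<close>)
  have Q0: "0 \<le> Q k" for k
    unfolding Q_def using gamma by (intro prod_nonneg) auto
  have contract: "\<gamma> (N - k + 1) * T (Suc k) \<le> (\<gamma> (N - k + 1) - 1) * T k" if k: "1 \<le> k" "k < N" for k
  proof -
    have "(\<Sum>j=1..<N. l j) = (\<Sum>j=1..<k. l j) + (\<Sum>j=k..<N. l j)"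
      using k by (simp add: sum.atLeastLessThan_concat)
    then have "S 1 = (\<Sum>j=1..<k. l j) + S k" by (simp add: S_def)
    moreover have Sk: "S k = l k + S (Suc k)"
      using k by (simp add: S_def sum.atLeast_Suc_lessThan)
    moreover have "V \<le> (\<Sum>j=1..<k. l j) + \<gamma> (N - k + 1) * \<sigma> k"
      using F k by (simp add: reduced_feasible_def)
    moreover have "\<gamma> (N - k + 1) * \<sigma> k \<le> \<gamma> (N - k + 1) * l k"
      using F k gamma[of "N - k + 1"] by (intro mult_left_mono) (auto simp: reduced_feasible_def)
    ultimately have "T k \<le> \<gamma> (N - k + 1) * l k" by (simp add: T_def D_def)
    moreover have "T k = l k + T (Suc k)" by (simp add: T_def Sk)
    ultimately show ?thesis by (simp add: algebra_simps)
  qed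
  have chain: "P k * T k \<le> Q k * T 1" if "1 \<le> k" "k \<le> N" for k
    using that
  proof (induction k rule: dec_induct)
    case base show ?case by (simp add: P_def Q_def)
  next
    case (step k)
    have "P (Suc k) * T (Suc k) = P k * (\<gamma> (N - k + 1) * T (Suc k))"
      using step by (simp add: P_def)
    also have "\<dots> \<le> P k * ((\<gamma> (N - k + 1) - 1) * T k)"
      using contract[of k] step P0[of k] by (intro mult_left_mono) auto
    also have "\<dots> = (\<gamma> (N - k + 1) - 1) * (P k * T k)" by simp
    also have "\<dots> \<le> (\<gamma> (N - k + 1) - 1) * (Q k * T 1)"
      using step gamma[of "N - k + 1"] by (intro mult_left_mono) auto
    also have "\<dots> = Q (Suc k) * T 1" using step by (simp add: Q_def)
    finally show ?case .
  qed
  have TN: "D * (1 + ef) \<le> ef * T N"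
  proof -
    have "D \<le> ef * Vf" using F by (simp add: D_def S_def reduced_feasible_def algebra_simps)
    then show ?thesis by (simp add: T_def S_def algebra_simps)
  qed
  have T1: "T 1 \<le> D + \<gamma> N - 1"
  proof -
    have "(\<Sum>j=0..<N. l j) + Vf \<le> \<gamma> N" "1 \<le> l 0"
      using F N by (force simp: reduced_feasible_def)+
    then show ?thesis using N by (simp add: T_def S_def sum.atLeast_Suc_lessThan)
  qed
  have "D * ((1 + ef) * P N) = P N * (D * (1 + ef))" by simp
  also have "\<dots> \<le> P N * (ef * T N)"
    using TN P0[of N] by (intro mult_left_mono) auto
  also have "\<dots> \<le> ef * (Q N * T 1)"
    using chain[of N] N ef by (simp add: mult.left_commute)
  also have "\<dots> \<le> ef * (Q N * (D + \<gamma> N - 1))"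
    using T1 Q0[of N] ef by (intro mult_left_mono) auto
  finally have "D * ((1 + ef) * P N - ef * Q N) \<le> ef * (\<gamma> N - 1) * Q N"
    by (simp add: algebra_simps)
  moreover have "0 < (1 + ef) * P N - ef * Q N"
    using denominator_pos[of "{1..<N}" "\<lambda>j. \<gamma> (N - j + 1)" ef] gamma ef
    by (simp add: P_def Q_def)
  ultimately have "D \<le> ef * (\<gamma> N - 1) * Q N / ((1 + ef) * P N - ef * Q N)"
    by (simp add: pos_le_divide_eq)
  then show ?thesis
    by (simp add: alpha_hat_def D_def S_def P_def Q_def)
qed

section \<open>Tightness for submultiplicative data\<close>

text \<open>
  The inequality wanted is essentially the case \<open>j = 0\<close>.  The shift \<open>j\<close> makes the induction on
  \<open>m\<close> work: the left-hand side depends on \<open>j\<close> and \<open>m\<close> only through \<open>j + m\<close>, apart from the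
  product, so the hypothesis is used at \<open>j + 1\<close>.  What remains is to compare the sums, where
  submultiplicativity bounds the sum shifted by \<open>j + 1\<close> by \<open>c (j + 1)\<close> times the unshifted one.
\<close>

lemma increment_bound_shifted:
  fixes c cf \<gamma> :: "nat \<Rightarrow> real"
  assumes gamma_eq: "\<And>k. k \<ge> 1 \<Longrightarrow> \<gamma> k = (\<Sum>j<k. c j) + cf k"
    and gamma: "\<And>k. k \<ge> 1 \<Longrightarrow> 1 \<le> \<gamma> k"
    and c_mult: "\<And>k k2. c (k + k2) \<le> c k * c k2"
    and cf_mult: "\<And>k k2. cf (k + k2) \<le> c k * cf k2"
    and decrease: "\<And>k. c k + cf (k + 1) \<le> (1 + ef) * cf k"
    and c0: "1 \<le> c 0" and ef: "ef > 0" and m: "m \<ge> 1"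
  shows "(1 + ef) * (c (j + m) + cf (j + m + 1) - cf (j + m)) * (\<Prod>i=2..m. \<gamma> i)
    \<le> ef * ((\<Sum>i=1..m. c (j + i)) + cf (j + m + 1)) * (\<Prod>i=2..m. \<gamma> i - 1)"
  using m
proof (induction m arbitrary: j rule: dec_induct)
  case base
  show ?case using decrease[of "j + 1"] by (simp add: algebra_simps)
next
  case (step m)
  define X where "X = (\<Sum>i=1..m. c (Suc j + i)) + cf (Suc j + m + 1)"
  define G where "G = \<gamma> (Suc m)"
  have G1: "1 \<le> G" using gamma by (simp add: G_def)
  have G_eq: "G = c 0 + ((\<Sum>i=1..m. c i) + cf (Suc m))"
  proof -
    have "(\<Sum>j<Suc m. c j) = c 0 + (\<Sum>i=1..m. c i)"
      by (simp add: sum.lessThan_Suc_shift sum.atLeast1_atMost_eq del: sum.lessThan_Suc)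
    then show ?thesis using gamma_eq[of "Suc m"] by (simp add: G_def)
  qed
  have X_le: "X \<le> c (Suc j) * (G - 1)"
  proof -
    have "X \<le> (\<Sum>i=1..m. c (Suc j) * c i) + c (Suc j) * cf (Suc m)"
      unfolding X_def
      by (intro add_mono sum_mono c_mult) (use cf_mult[of "Suc j" "Suc m"] in simp)
    also have "\<dots> = c (Suc j) * (G - c 0)"
      by (simp add: G_eq sum_distrib_left algebra_simps)
    \<comment> \<open>\<open>c (Suc j)\<close> may be negative, but only if \<open>c 0 = 1\<close>.\<close>
    also have "\<dots> \<le> c (Suc j) * (G - 1)"
    proof -
      have "0 \<le> (c 0 - 1) * c (Suc j)" using c_mult[of 0 "Suc j"] by (simp add: algebra_simps)
      then show ?thesis by (simp add: algebra_simps)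
    qed
    finally show ?thesis .
  qed
  have Q0: "0 \<le> (\<Prod>i=2..m. \<gamma> i - 1)" using gamma by (intro prod_nonneg) auto
  have split: "(\<Prod>i=2..Suc m. f i) = (\<Prod>i=2..m. f i) * f (Suc m)" for f :: "nat \<Rightarrow> real"
    using step by (simp add: prod.nat_ivl_Suc' mult.commute)
  have sum_eq: "(\<Sum>i=1..Suc m. c (j + i)) + cf (j + Suc m + 1) = c (Suc j) + X"
    unfolding X_def One_nat_def sum.atLeast1_atMost_eq
    by (simp add: sum.lessThan_Suc_shift del: sum.lessThan_Suc)
  have "(1 + ef) * (c (j + Suc m) + cf (j + Suc m + 1) - cf (j + Suc m)) * (\<Prod>i=2..Suc m. \<gamma> i)
      = G * ((1 + ef) * (c (Suc j + m) + cf (Suc j + m + 1) - cf (Suc j + m)) * (\<Prod>i=2..m. \<gamma> i))"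
    using step.hyps by (simp add: G_def)
  also have "\<dots> \<le> G * (ef * X * (\<Prod>i=2..m. \<gamma> i - 1))"
    using step.IH[of "Suc j"] G1 unfolding X_def by (intro mult_left_mono) auto
  also have "\<dots> = ef * (\<Prod>i=2..m. \<gamma> i - 1) * (G * X)" by simp
  also have "\<dots> \<le> ef * (\<Prod>i=2..m. \<gamma> i - 1) * ((c (Suc j) + X) * (G - 1))"
    using X_le Q0 ef by (intro mult_left_mono) (auto simp: algebra_simps)
  also have "\<dots> = ef * ((\<Sum>i=1..Suc m. c (j + i)) + cf (j + Suc m + 1)) * (\<Prod>i=2..Suc m. \<gamma> i - 1)"
    by (simp only: sum_eq split G_def) (simp add: mult_ac)
  finally show ?case .
qed

lemma increment_bound:
  fixes c cf \<gamma> :: "nat \<Rightarrow> real"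
  assumes gamma_eq: "\<And>k. k \<ge> 1 \<Longrightarrow> \<gamma> k = (\<Sum>j<k. c j) + cf k"
    and gamma: "\<And>k. k \<ge> 1 \<Longrightarrow> 1 \<le> \<gamma> k"
    and c_mult: "\<And>k k2. c (k + k2) \<le> c k * c k2"
    and cf_mult: "\<And>k k2. cf (k + k2) \<le> c k * cf k2"
    and decrease: "\<And>k. c k + cf (k + 1) \<le> (1 + ef) * cf k"
    and ef: "ef > 0" and m: "m \<ge> 1"
  shows "(1 + ef) * (\<gamma> (m + 1) - \<gamma> m) * (\<Prod>i=2..m. \<gamma> i) \<le> ef * (\<Prod>i=2..m + 1. \<gamma> i - 1)"
proof -
  \<comment> \<open>Otherwise \<open>c 0 \<le> c 0 * c 0\<close> and \<open>cf 1 \<le> c 0 * cf 1\<close> make both summands of \<open>\<gamma> 1\<close>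
    nonpositive.\<close>
  have c0: "1 \<le> c 0"
  proof (rule ccontr)
    assume "\<not> 1 \<le> c 0"
    have "0 \<le> (c 0 - 1) * c 0" "0 \<le> (c 0 - 1) * cf 1"
      using c_mult[of 0 0] cf_mult[of 0 1] by (simp_all add: algebra_simps)
    then have "c 0 \<le> 0" "cf 1 \<le> 0"
      using \<open>\<not> 1 \<le> c 0\<close> by (simp_all add: zero_le_mult_iff)
    then show False using gamma[of 1] gamma_eq[of 1] by simp
  qed
  have sum: "(\<Sum>i=1..m. c i) + cf (m + 1) = \<gamma> (m + 1) - c 0"
  proof -
    have "(\<Sum>j<Suc m. c j) = c 0 + (\<Sum>i=1..m. c i)"
      by (simp add: sum.lessThan_Suc_shift sum.atLeast1_atMost_eq del: sum.lessThan_Suc)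
    then show ?thesis using gamma_eq[of "m + 1"] by simp
  qed
  have "c m + cf (m + 1) - cf m = \<gamma> (m + 1) - \<gamma> m"
    using gamma_eq[of m] gamma_eq[of "m + 1"] m by simp
  then have "(1 + ef) * (\<gamma> (m + 1) - \<gamma> m) * (\<Prod>i=2..m. \<gamma> i)
      \<le> ef * (\<gamma> (m + 1) - c 0) * (\<Prod>i=2..m. \<gamma> i - 1)"
    using increment_bound_shifted[OF gamma_eq gamma c_mult cf_mult decrease c0 ef m, of 0] sum
    by simp
  also have "\<dots> \<le> ef * (\<gamma> (m + 1) - 1) * (\<Prod>i=2..m. \<gamma> i - 1)"
    using c0 ef gamma by (intro mult_right_mono mult_left_mono prod_nonneg) auto
  also have "\<dots> = ef * (\<Prod>i=2..m + 1. \<gamma> i - 1)"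
    using m by (simp add: prod.nat_ivl_Suc')
  finally show ?thesis .
qed

lemma prod_reversed_split:
  fixes f :: "nat \<Rightarrow> real"
  assumes "m < N"
  shows "(\<Prod>j=1..<N. f (N - j + 1)) = (\<Prod>j=1..<N - m. f (N - j + 1)) * (\<Prod>i=2..m + 1. f i)"
proof -
  have "(\<Prod>j=N - m..<N. f (N - j + 1)) = (\<Prod>i=2..m + 1. f i)"
    using assms
    by (intro prod.reindex_bij_witness[of _ "\<lambda>i. N - i + 1" "\<lambda>j. N - j + 1"]) auto
  then show ?thesis
    using assms prod.atLeastLessThan_concat[of 1 "N - m" N "\<lambda>j. f (N - j + 1)"] by simp
qed

text \<open>
  The point is found by demanding equality throughout the proof of \<open>objective_lower_bound\<close>:
  each step then contracts \<open>T\<close> by exactly \<open>1 - 1 / \<gamma> (N - k + 1)\<close>, which makes \<open>T k\<close> a multiple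
  of \<open>Q k / P k\<close>, and \<open>D\<close> is the value at which the two end conditions on \<open>T\<close> agree.  Everything else is read
  off from \<open>T\<close> and \<open>D\<close>.  Here \<open>D\<close> is a quotient with positive denominator even if some
  \<open>\<gamma> k = 1\<close>, which covers the degenerate data too.
\<close>

lemma extremal_point_exists:
  fixes \<gamma> :: "nat \<Rightarrow> real"
  assumes N: "N \<ge> 1" and gamma: "\<And>k. k \<ge> 1 \<Longrightarrow> 1 \<le> \<gamma> k" and ef: "ef > 0"
    and c_bounds: "c_lo \<le> \<gamma> 1 / (1 + ef)" "\<gamma> 1 / (1 + ef) \<le> c_up"
    and incr: "\<And>m. m \<ge> 1 \<Longrightarrow>
      (1 + ef) * (\<gamma> (m + 1) - \<gamma> m) * (\<Prod>i=2..m. \<gamma> i) \<le> ef * (\<Prod>i=2..m + 1. \<gamma> i - 1)"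
  obtains l \<sigma> V Vf where "reduced_feasible N \<gamma> ef c_lo c_up l \<sigma> V Vf"
    and "(\<Sum>k=1..<N. l k) + Vf - V = alpha_hat N \<gamma> ef - 1"
proof -
  define P where "P k = (\<Prod>j=1..<k. \<gamma> (N - j + 1))" for k
  define Q where "Q k = (\<Prod>j=1..<k. \<gamma> (N - j + 1) - 1)" for k
  define \<Delta> where "\<Delta> = (1 + ef) * P N - ef * Q N"
  define D where "D = ef * (\<gamma> N - 1) * Q N / \<Delta>"
  define T where "T k = (D + \<gamma> N - 1) * Q k / P k" for k
  define S where "S k = T k - D" for k
  define l where "l k = (if k = 0 then 1 else S k - S (Suc k))" for k
  define Vf where "Vf = D / ef"
  \<comment> \<open>\<open>\<sigma> N\<close> is chosen such that the stage bound on \<open>V\<close> at \<open>k = N\<close> coincides with the terminal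
    one; then \<open>Vf\<close> is \<open>\<sigma> N\<close> times \<open>\<gamma> 1 / (1 + ef)\<close>, a factor between \<open>c_lo\<close> and \<open>c_up\<close>.\<close>
  define \<sigma> where "\<sigma> k = (if k = N then (1 + ef) * Vf / \<gamma> 1 else l k)" for k
  define V where "V = D + S 1"

  have g0: "0 < \<gamma> k" if "k \<ge> 1" for k using gamma[OF that] by simp
  have P0: "0 < P k" for k
    unfolding P_def using g0 by (intro prod_pos) auto
  have Q0: "0 \<le> Q k" for k
    unfolding Q_def using gamma by (intro prod_nonneg) auto
  have \<Delta>0: "0 < \<Delta>"
    using denominator_pos[of "{1..<N}" "\<lambda>j. \<gamma> (N - j + 1)" ef] gamma ef
    by (simp add: P_def Q_def \<Delta>_def)
  have D0: "0 \<le> D"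
    unfolding D_def using ef gamma[OF N] Q0 \<Delta>0 by simp
  have Vf0: "0 \<le> Vf" using D0 ef by (simp add: Vf_def)
  have T0: "0 \<le> T k" for k
    unfolding T_def using D0 gamma[OF N] Q0[of k] P0[of k] by simp
  have T1: "T 1 = D + \<gamma> N - 1" by (simp add: T_def P_def Q_def)
  have D_eq: "ef * Q N * (D + \<gamma> N - 1) = (1 + ef) * D * P N"
  proof -
    have "D * \<Delta> = ef * (\<gamma> N - 1) * Q N" using \<Delta>0 by (simp add: D_def)
    then show ?thesis by (simp add: \<Delta>_def algebra_simps)
  qed
  have D_Vf: "D = ef * Vf" using ef by (simp add: Vf_def)
  have SN: "S N = Vf"
  proof -
    have "ef * T N = (1 + ef) * D" using D_eq P0[of N] by (simp add: T_def field_simps)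
    then show ?thesis using ef by (simp add: S_def Vf_def field_simps)
  qed
  have T_step: "T k = \<gamma> (N - k + 1) * l k" if k: "1 \<le> k" "k < N" for k
  proof -
    have PQ: "P (Suc k) = P k * \<gamma> (N - k + 1)" "Q (Suc k) = Q k * (\<gamma> (N - k + 1) - 1)"
      using k by (simp_all add: P_def Q_def)
    have "\<gamma> (N - k + 1) \<noteq> 0" using g0[of "N - k + 1"] by simp
    then have "\<gamma> (N - k + 1) * T (Suc k) = (\<gamma> (N - k + 1) - 1) * T k"
      by (simp add: T_def PQ)
    then show ?thesis using k by (simp add: l_def S_def algebra_simps)
  qed
  have l0: "0 \<le> l k" if "k < N" for k
  proof (cases "k = 0")
    case True then show ?thesis by (simp add: l_def)
  next
    case False
    then have "0 \<le> \<gamma> (N - k + 1) * l k" using T_step[of k] T0[of k] that by simp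
    then show ?thesis using g0[of "N - k + 1"] by (simp add: zero_le_mult_iff)
  qed
  have tail: "(\<Sum>j=k..<N. l j) + Vf = S k" if "1 \<le> k" "k \<le> N" for k
    using that(2,1)
  proof (induction k rule: inc_induct)
    case base then show ?case by (simp add: SN)
  next
    case (step k)
    then show ?case by (simp add: sum.atLeast_Suc_lessThan l_def)
  qed
  have head: "(\<Sum>j=1..<k. l j) = S 1 - S k" if "1 \<le> k" "k \<le> N" for k
    using that
    by (induction k rule: dec_induct) (auto simp: l_def)
  have s0: "0 \<le> \<sigma> k" if "k \<le> N" for k
    using that l0[of k] Vf0 ef g0[of 1] by (auto simp: \<sigma>_def)
  have first: "(\<Sum>j=k..<N. l j) + Vf \<le> \<gamma> (N - k) * l k" if k: "k < N" for k
  proof (cases "k = 0")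
    case True
    have "(\<Sum>j=0..<N. l j) + Vf = 1 + S 1"
      using N tail[of 1] by (simp add: sum.atLeast_Suc_lessThan l_def)
    then show ?thesis using True T1 by (simp add: l_def S_def)
  next
    case False
    define m where "m = N - k"
    have m: "1 \<le> m" "m < N" "k = N - m" "N - k + 1 = m + 1" "N - k = m"
      using False k by (auto simp: m_def)
    define R where "R = (\<Prod>i=2..m. \<gamma> i)"
    have R0: "0 < R" unfolding R_def using g0 by (intro prod_pos) auto
    have PN: "P N = P k * (R * \<gamma> (m + 1))"
      using prod_reversed_split[OF m(2), of \<gamma>] m(1)
      by (simp add: P_def R_def m(3)[symmetric] prod.nat_ivl_Suc')
    have QN: "Q N = Q k * (\<Prod>i=2..m + 1. \<gamma> i - 1)"
      using prod_reversed_split[OF m(2), of "\<lambda>i. \<gamma> i - 1"]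
      by (simp add: Q_def m(3)[symmetric])
    \<comment> \<open>After multiplication with \<open>T k\<close>, the products of \<open>incr\<close> complete to \<open>P N\<close> and
      \<open>Q N\<close>, whose ratio is fixed by the equation for \<open>D\<close>.\<close>
    have "(1 + ef) * R * ((\<gamma> (m + 1) - \<gamma> m) * T k)
        = ((1 + ef) * (\<gamma> (m + 1) - \<gamma> m) * R) * T k" by simp
    also have "\<dots> \<le> (ef * (\<Prod>i=2..m + 1. \<gamma> i - 1)) * T k"
      using incr[OF m(1)] T0[of k] unfolding R_def by (intro mult_right_mono) auto
    also have "\<dots> = ef * Q N * (D + \<gamma> N - 1) / P k"
      by (simp add: T_def QN)
    also have "\<dots> = (1 + ef) * R * (\<gamma> (m + 1) * D)"
      using P0[of k] by (simp add: D_eq PN)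
    finally have "(\<gamma> (m + 1) - \<gamma> m) * T k \<le> \<gamma> (m + 1) * D"
      using R0 ef by (simp add: mult_le_cancel_left_pos)
    then have "\<gamma> (m + 1) * S k \<le> \<gamma> m * T k"
      by (simp add: S_def algebra_simps)
    also have "\<dots> = \<gamma> (m + 1) * (\<gamma> m * l k)"
      using T_step[of k] False k m(4) by simp
    finally have "S k \<le> \<gamma> m * l k"
      using g0[of "m + 1"] by (simp add: mult_le_cancel_left_pos)
    then show ?thesis using tail[of k] False k m(5) by simp
  qed
  have second: "V \<le> (\<Sum>j=1..<k. l j) + \<gamma> (N - k + 1) * \<sigma> k" if k: "1 \<le> k" "k \<le> N" for k
  proof (cases "k = N")
    case True
    have "\<gamma> 1 * \<sigma> N = (1 + ef) * Vf" using g0[of 1] by (simp add: \<sigma>_def)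
    then show ?thesis
      using True head[of N] N SN D_Vf by (simp add: V_def algebra_simps)
  next
    case False
    then have "\<gamma> (N - k + 1) * \<sigma> k = D + S k"
      using T_step[of k] k by (simp add: \<sigma>_def S_def)
    then show ?thesis using head[of k] k by (simp add: V_def)
  qed
  have "reduced_feasible N \<gamma> ef c_lo c_up l \<sigma> V Vf"
    unfolding reduced_feasible_def
  proof (intro conjI ballI)
    show "\<sigma> 0 = 1" using N by (simp add: \<sigma>_def l_def)
    show "0 \<le> Vf" by (fact Vf0)
    show "0 \<le> \<sigma> k" if "k \<in> {..N}" for k using that s0 by simp
    show "\<sigma> k \<le> l k" if "k \<in> {..<N}" for k using that by (simp add: \<sigma>_def)
    show "(\<Sum>j=k..<N. l j) + Vf \<le> \<gamma> (N - k) * \<sigma> k" if "k \<in> {..<N}" for k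
      using that first[of k] by (simp add: \<sigma>_def)
    show "V \<le> (\<Sum>j=1..<k. l j) + \<gamma> (N - k + 1) * \<sigma> k" if "k \<in> {1..N}" for k
      using that second by simp
    show "V \<le> (\<Sum>j=1..<N. l j) + (1 + ef) * Vf"
      using head[of N] N SN D_Vf by (simp add: V_def algebra_simps)
    have sN: "\<sigma> N * \<gamma> 1 = (1 + ef) * Vf" using g0[of 1] by (simp add: \<sigma>_def)
    have "\<gamma> 1 / (1 + ef) * \<sigma> N = Vf" using sN ef by (simp add: field_simps)
    then show "c_lo * \<sigma> N \<le> Vf" "Vf \<le> c_up * \<sigma> N"
      using mult_right_mono[OF c_bounds(1) s0[of N]] mult_right_mono[OF c_bounds(2) s0[of N]]
      by simp_all
  qed
  moreover have "(\<Sum>k=1..<N. l k) + Vf - V = alpha_hat N \<gamma> ef - 1"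
    using tail[of 1] N by (simp add: V_def alpha_hat_def D_def P_def Q_def \<Delta>_def)
  ultimately show ?thesis using that by blast
qed

section \<open>Positivity for long horizons\<close>

text \<open>
  For \<open>g > 1\<close> this is the logarithm of the conclusion, solved for \<open>N\<close>.  For \<open>g = 1\<close> the horizon
  bound is \<open>1\<close>, so \<open>N \<ge> 2\<close> and the power vanishes.
\<close>

lemma power_bound_of_horizon:
  fixes g ef :: real
  assumes N: "N \<ge> 1" and g: "g \<ge> 1" and ef: "ef > 0" and large: "real N > N_lower g ef"
  shows "ef * (g * (1 - 1 / g) ^ (N - 1)) < 1 + ef"
proof (cases "g = 1")
  case True
  then have "N > 1" using large by (simp add: N_lower_def)
  then show ?thesis using True ef by (simp add: power_0_left)
next
  case False
  then have g1: "g > 1" using g by simp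
  define \<delta> where "\<delta> = ln g - ln (g - 1)"
  have \<delta>: "\<delta> > 0" using g1 by (simp add: \<delta>_def)
  have "ln g - ln (1 + 1 / ef) < real (N - 1) * \<delta>"
  proof -
    have "(ln g - ln (1 + 1 / ef)) / \<delta> < real (N - 1)"
      using large N by (simp add: N_lower_def \<delta>_def of_nat_diff)
    then show ?thesis using \<delta> by (simp add: pos_divide_less_eq)
  qed
  moreover have "ln (1 - 1 / g) = - \<delta>"
  proof -
    have "1 - 1 / g = (g - 1) / g" using g1 by (simp add: field_simps)
    then show ?thesis using g1 by (simp add: \<delta>_def ln_div)
  qed
  moreover have q: "0 < 1 - 1 / g" using g1 by simp
  ultimately have "ln (g * (1 - 1 / g) ^ (N - 1)) < ln (1 + 1 / ef)"
    using g1 by (simp add: ln_mult ln_realpow)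
  moreover have "0 < g * (1 - 1 / g) ^ (N - 1)" using g1 q by simp
  ultimately have "g * (1 - 1 / g) ^ (N - 1) < 1 + 1 / ef"
    using ef by (subst (asm) ln_less_cancel_iff) (auto simp: add_pos_pos)
  then show ?thesis using ef by (simp add: field_simps)
qed

lemma alpha_hat_pos:
  fixes \<gamma> :: "nat \<Rightarrow> real"
  assumes N: "N \<ge> 1" and gamma: "\<And>k. k \<ge> 1 \<Longrightarrow> 1 \<le> \<gamma> k \<and> \<gamma> k \<le> g"
    and ef: "ef > 0" and large: "real N > N_lower g ef"
  shows "alpha_hat N \<gamma> ef > 0"
proof -
  define P where "P = (\<Prod>j=1..<N. \<gamma> (N - j + 1))"
  define Q where "Q = (\<Prod>j=1..<N. \<gamma> (N - j + 1) - 1)"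
  have g: "g \<ge> 1" using gamma[of 1] by simp
  have g0: "0 < \<gamma> k" if "k \<ge> 1" for k using gamma[OF that] by simp
  have P0: "0 < P" unfolding P_def using g0 by (intro prod_pos) auto
  have Q0: "0 \<le> Q" unfolding Q_def using gamma by (intro prod_nonneg) auto
  have \<Delta>0: "0 < (1 + ef) * P - ef * Q"
    using denominator_pos[of "{1..<N}" "\<lambda>j. \<gamma> (N - j + 1)" ef] gamma ef
    by (simp add: P_def Q_def)
  have "Q / P = (\<Prod>j=1..<N. 1 - 1 / \<gamma> (N - j + 1))"
    unfolding P_def Q_def prod_dividef[symmetric]
    using g0 by (intro prod.cong) (auto simp: diff_divide_distrib less_imp_neq[THEN not_sym])
  also have "\<dots> \<le> (\<Prod>j=1..<N. 1 - 1 / g)"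
    using gamma g0 g by (intro prod_mono) (auto intro!: divide_left_mono)
  finally have "Q / P \<le> (1 - 1 / g) ^ (N - 1)" by simp
  then have "\<gamma> N * (Q / P) \<le> g * (1 - 1 / g) ^ (N - 1)"
    using gamma[OF N] P0 Q0 g by (intro mult_mono) auto
  then have "ef * (\<gamma> N * (Q / P)) \<le> ef * (g * (1 - 1 / g) ^ (N - 1))"
    using ef by (intro mult_left_mono) auto
  also have "\<dots> < 1 + ef" by (rule power_bound_of_horizon[OF N g ef large])
  finally have "ef * (\<gamma> N * Q) < (1 + ef) * P" using P0 by (simp add: field_simps)
  then have "ef * (\<gamma> N - 1) * Q < (1 + ef) * P - ef * Q" by (simp add: algebra_simps)
  then show ?thesis using \<Delta>0 by (simp add: alpha_hat_def P_def Q_def)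
qed

theorem theorem7:
  fixes N :: nat and g_up :: real and \<gamma> :: "nat \<Rightarrow> real"
    and c_lo c_up ef :: real and go_lo go_up eo :: real
  assumes N: "N \<ge> 1"
    and g_up: "g_up \<ge> 1"
    and gamma: "\<And>k. k \<ge> 1 \<Longrightarrow> 1 \<le> \<gamma> k \<and> \<gamma> k \<le> g_up"
    and pos: "c_lo > 0" "c_up > 0" "ef > 0"
    and c_bounds: "c_lo \<le> \<gamma> 1 / (1 + ef)" "\<gamma> 1 / (1 + ef) \<le> c_up"
    and o_params: "go_lo = 0" "go_up = 0" "eo = 1"
  shows "alpha N \<gamma> go_lo go_up eo ef c_lo c_up \<ge> alpha_hat N \<gamma> ef \<and>
    ((\<exists>c cf :: nat \<Rightarrow> real.
        (\<forall>k\<ge>1. \<gamma> k = (\<Sum>j<k. c j) + cf k) \<and>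
        (\<forall>k k2. c (k + k2) \<le> c k * c k2 \<and> cf (k + k2) \<le> c k * cf k2 \<and>
           c k + cf (k + 1) \<le> (1 + ef) * cf k)) \<longrightarrow>
      alpha_hat N \<gamma> ef = alpha N \<gamma> go_lo go_up eo ef c_lo c_up) \<and>
    (real N > N_lower g_up ef \<longrightarrow> alpha N \<gamma> go_lo go_up eo ef c_lo c_up > 0)"
proof -
  have gamma1: "1 \<le> \<gamma> k" if "k \<ge> 1" for k using gamma[OF that] by simp
  obtain l \<sigma> V Vf where F: "reduced_feasible N \<gamma> ef c_lo c_up l \<sigma> V Vf"
    and min_eq: "lp_min N \<gamma> 0 0 1 ef c_lo c_up = (\<Sum>k=1..<N. l k) + Vf - V"
    using lp_min_attained[where \<gamma> = \<gamma>, OF N gamma1 pos(1,3)] by blast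
  have ge: "alpha_hat N \<gamma> ef \<le> alpha N \<gamma> 0 0 1 ef c_lo c_up"
    using objective_lower_bound[OF F N gamma1 pos(3)] min_eq by (simp add: alpha_def)
  have eq: "alpha_hat N \<gamma> ef = alpha N \<gamma> 0 0 1 ef c_lo c_up"
    if "\<exists>c cf :: nat \<Rightarrow> real.
        (\<forall>k\<ge>1. \<gamma> k = (\<Sum>j<k. c j) + cf k) \<and>
        (\<forall>k k2. c (k + k2) \<le> c k * c k2 \<and> cf (k + k2) \<le> c k * cf k2 \<and>
           c k + cf (k + 1) \<le> (1 + ef) * cf k)"
  proof -
    from that obtain c cf :: "nat \<Rightarrow> real" where c:
      "\<And>k. k \<ge> 1 \<Longrightarrow> \<gamma> k = (\<Sum>j<k. c j) + cf k"
      "\<And>k k2. c (k + k2) \<le> c k * c k2"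
      "\<And>k k2. cf (k + k2) \<le> c k * cf k2"
      "\<And>k. c k + cf (k + 1) \<le> (1 + ef) * cf k"
      by blast
    obtain l' \<sigma>' V' Vf' where F': "reduced_feasible N \<gamma> ef c_lo c_up l' \<sigma>' V' Vf'"
      and obj: "(\<Sum>k=1..<N. l' k) + Vf' - V' = alpha_hat N \<gamma> ef - 1"
      using extremal_point_exists[where \<gamma> = \<gamma>, OF N gamma1 pos(3) c_bounds
          increment_bound[where \<gamma> = \<gamma>, OF c(1) gamma1 c(2-4) pos(3)]] by blast
    have "lp_min N \<gamma> 0 0 1 ef c_lo c_up = (\<Sum>k=1..<N. l' k) + Vf' - V'"
      by (rule lp_min_eqI[OF F']) (use objective_lower_bound[OF _ N gamma1 pos(3)] obj in simp)
    then show ?thesis using obj by (simp add: alpha_def)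
  qed
  show ?thesis
    using ge eq alpha_hat_pos[where \<gamma> = \<gamma>, OF N gamma pos(3)] unfolding o_params by fastforce
qed

end
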